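(* There exists a $(k^2,k;4)$-MOHS for each $k\in\{9,21,27\}$, and there exists a $(121,11;9)$-MOHS.
   Context: Let $G$ be an abelian group of odd order $2v+1\ge 7$. A half-set of $G$ is a subset $V\subseteq G\setminus\{0\}$ containing exactly one element of each pair $\{g,-g\}$, $g\ne 0$. A $(v,k)$ Heffter system on $V$ is a partition of $V$ into blocks of size $k$, each summing to $0$ in $G$. Two Heffter systems on the same half-set are orthogonal if every block of one meets every block of the other in at most one element. A $(v,k;r)$-MOHS is a set of $r$ pairwise orthogonal $(v,k)$ Heffter systems on a common half-set of some abelian group of order $2v+1$. *)

theory Defs
  imports "HOL-Algebra.Algebra"
begin

text \<open>Abelian groups are HOL-Algebra structures written multiplicatively:
  the group operation plays the role of +, the unit that of 0, inverse that of negation,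
  and finprod that of the sum over a finite block.\<close>

definition half_set :: "('a, 'b) monoid_scheme \<Rightarrow> 'a set \<Rightarrow> bool" where
  "half_set G V \<longleftrightarrow> V \<subseteq> carrier G - {\<one>\<^bsub>G\<^esub>} \<and>
     (\<forall>g \<in> carrier G - {\<one>\<^bsub>G\<^esub>}. (g \<in> V) \<noteq> (inv\<^bsub>G\<^esub> g \<in> V))"

definition heffter_system :: "('a, 'b) monoid_scheme \<Rightarrow> 'a set \<Rightarrow> nat \<Rightarrow> 'a set set \<Rightarrow> bool" where
  "heffter_system G V k P \<longleftrightarrow>
     \<Union>P = V \<and>
     (\<forall>B \<in> P. \<forall>C \<in> P. B \<noteq> C \<longrightarrow> B \<inter> C = {}) \<and>
     (\<forall>B \<in> P. finite B \<and> card B = k \<and> finprod G (\<lambda>x. x) B = \<one>\<^bsub>G\<^esub>)"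

definition orthogonal_systems :: "'a set set \<Rightarrow> 'a set set \<Rightarrow> bool" where
  "orthogonal_systems P Q \<longleftrightarrow> (\<forall>B \<in> P. \<forall>C \<in> Q. card (B \<inter> C) \<le> 1)"

text \<open>A (v,k;r)-MOHS: r pairwise orthogonal (v,k) Heffter systems on a common half-set of
  some abelian group of order 2v+1.  Every finite group is isomorphic to one whose carrier
  is a set of naturals, so quantifying over groups with element type nat loses nothing.\<close>

definition MOHS :: "nat \<Rightarrow> nat \<Rightarrow> nat \<Rightarrow> bool" where
  "MOHS v k r \<longleftrightarrow>
     (\<exists>(G :: nat monoid) V S.
        comm_group G \<and> finite (carrier G) \<and> card (carrier G) = 2 * v + 1 \<and>
        half_set G V \<and> card S = r \<and>
        (\<forall>P \<in> S. heffter_system G V k P) \<and>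
        (\<forall>P \<in> S. \<forall>Q \<in> S. P \<noteq> Q \<longrightarrow> orthogonal_systems P Q))"

end

theory Submission
  imports Defs "HOL-Number_Theory.Cong"
begin

text \<open>Let an automorphism \<open>\<phi>\<close> of an abelian group of order \<open>2k\<^sup>2 + 1\<close>, with \<open>k\<close> odd, have an orbit of length
  \<open>k\<^sup>2\<close>. Such an orbit contains no element together with its inverse, so it is a half-set. Index its points
  by \<open>\<int>\<^sub>k \<times> \<int>\<^sub>k\<close>, the pair \<open>(i, j)\<close> standing for \<open>\<phi>\<close> applied \<open>i + kj\<close> times. The cosets \<open>{i} \<times> \<int>\<^sub>k\<close> form one
  system, and the translates of the graph of \<open>i \<mapsto> c i + a * d i\<close> form another one for each \<open>a\<close>. If \<open>d\<close> is a
  permutation of \<open>\<int>\<^sub>k\<close> and the differences of the chosen \<open>a\<close> are units of \<open>\<int>\<^sub>k\<close>, these systems are orthogonal.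
  Since \<open>\<phi> ^^ k\<close> maps each translate to the next, only one sum per system has to be checked.

  For \<open>k = 9, 21, 27\<close> the order \<open>2k\<^sup>2 + 1\<close> is the prime \<open>163, 883, 1459\<close>, \<open>\<phi>\<close> is multiplication by an element
  of order \<open>k\<^sup>2\<close>, and a random search for \<open>c\<close> succeeds. For \<open>k = 11\<close> the group is the field
  with \<open>3\<^sup>5\<close> elements and \<open>c\<close>, \<open>d\<close> are chosen such that every graph is invariant under the Frobenius map; its sum
  then lies in the prime field, and so vanishes with probability about \<open>1/3\<close>.\<close>

section \<open>Products under homomorphisms and transport of systems to groups on the
  naturals\<close>

lemma finprod_hom:
  assumes "comm_group G" "comm_group H" "h \<in> hom G H" "f \<in> A \<rightarrow> carrier G"
  shows "h (finprod G f A) = finprod H (\<lambda>x. h (f x)) A"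
proof -
  interpret G: comm_group G by fact
  interpret H: comm_group H by fact
  interpret group_hom G H h
    using assms(3) by unfold_locales
  show ?thesis
    using assms(4)
  proof (induction A rule: infinite_finite_induct)
    case (insert a A)
    then have "f a \<in> carrier G" "f \<in> A \<rightarrow> carrier G" "(\<lambda>x. h (f x)) \<in> A \<rightarrow> carrier H"
      by (auto simp: Pi_iff)
    with insert show ?case by simp
  qed simp_all
qed

lemma (in comm_monoid) finprod_set_eq_foldr:
  assumes "distinct xs" "f \<in> set xs \<rightarrow> carrier G"
  shows "finprod G f (set xs) = foldr (\<otimes>) (map f xs) \<one>"
  using assms
proof (induction xs)
  case (Cons a xs)
  then have "f a \<in> carrier G" "f \<in> set xs \<rightarrow> carrier G"
    by auto
  with Cons show ?case by simp
qed simp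

text \<open>\<open>MOHS\<close> asks for a carrier of naturals, whereas the constructions use lists
  of integers. Transporting the group along the injection \<open>to_nat\<close> preserves products,
  inverses and block intersections.\<close>

lemma MOHS_transfer:
  fixes G :: "'a::countable monoid"
  assumes "comm_group G" "finite (carrier G)" "card (carrier G) = 2 * v + 1"
    and V: "half_set G V"
    and "card S = r"
    and S: "\<And>P. P \<in> S \<Longrightarrow> heffter_system G V k P"
    and orth: "\<And>P Q. P \<in> S \<Longrightarrow> Q \<in> S \<Longrightarrow> P \<noteq> Q \<Longrightarrow> orthogonal_systems P Q"
  shows "MOHS v k r"
proof -
  interpret G: comm_group G by fact
  let ?f = "to_nat :: 'a \<Rightarrow> nat"
  define H where "H = \<lparr>carrier = ?f ` carrier G,
    monoid.mult = (\<lambda>a b. ?f (from_nat a \<otimes>\<^bsub>G\<^esub> from_nat b)), one = ?f \<one>\<^bsub>G\<^esub>\<rparr>"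
  have carrier_H: "carrier H = ?f ` carrier G" and one_H: "\<one>\<^bsub>H\<^esub> = ?f \<one>\<^bsub>G\<^esub>"
    by (simp_all add: H_def)
  have inj: "inj ?f"
    by simp
  have iso: "?f \<in> iso G H"
    by (auto simp: iso_def hom_def bij_betw_def H_def intro: inj_on_subset[OF inj])
  have "monoid H"
    by (rule monoidI) (auto simp: H_def G.m_assoc)
  then have H: "comm_group H"
    using G.iso_imp_comm_group iso by (auto simp: is_iso_def)
  then interpret H: comm_group H .
  interpret group_hom G H ?f
    using iso by unfold_locales (simp add: iso_def)
  have card_H: "card (carrier H) = 2 * v + 1" and fin_H: "finite (carrier H)"
    using assms(2,3) by (simp_all add: carrier_H card_image)
  have V_sub: "V \<subseteq> carrier G"
    using V by (auto simp: half_set_def)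
  have "half_set H (?f ` V)"
    unfolding half_set_def
  proof (intro conjI ballI)
    have "?f g \<noteq> \<one>\<^bsub>H\<^esub>" if "g \<in> V" for g
      using that V one_H by (auto simp: half_set_def simp del: hom_one)
    then show "?f ` V \<subseteq> carrier H - {\<one>\<^bsub>H\<^esub>}"
      using V_sub by (auto simp: carrier_H)
  next
    fix y assume "y \<in> carrier H - {\<one>\<^bsub>H\<^esub>}"
    then obtain g where g: "y = ?f g" "g \<in> carrier G" and "y \<noteq> \<one>\<^bsub>H\<^esub>"
      by (auto simp: carrier_H)
    then have "g \<noteq> \<one>\<^bsub>G\<^esub>"
      by auto
    with g have "(g \<in> V) \<noteq> (inv\<^bsub>G\<^esub> g \<in> V)"
      using V unfolding half_set_def by blast
    moreover have "inv\<^bsub>H\<^esub> y = ?f (inv\<^bsub>G\<^esub> g)"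
      using g by simp
    ultimately show "(y \<in> ?f ` V) \<noteq> (inv\<^bsub>H\<^esub> y \<in> ?f ` V)"
      using g(1) inj_image_mem_iff[OF inj] by metis
  qed
  moreover have "heffter_system H (?f ` V) k (image ?f ` P)" if "P \<in> S" for P
  proof -
    have P: "\<Union>P = V" "\<And>B C. B \<in> P \<Longrightarrow> C \<in> P \<Longrightarrow> B \<noteq> C \<Longrightarrow> B \<inter> C = {}"
      "\<And>B. B \<in> P \<Longrightarrow> finite B \<and> card B = k \<and> finprod G (\<lambda>x. x) B = \<one>\<^bsub>G\<^esub>"
      using S[OF that] by (auto simp: heffter_system_def)
    have "finprod H (\<lambda>x. x) (?f ` B) = \<one>\<^bsub>H\<^esub>" if "B \<in> P" for B
    proof -
      have B: "B \<subseteq> carrier G"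
        using P(1) that V_sub by blast
      have "finprod H (\<lambda>x. x) (?f ` B) = finprod H (\<lambda>x. ?f x) B"
        using B by (subst H.finprod_reindex) (auto simp: carrier_H intro: inj_on_subset[OF inj])
      also have "\<dots> = ?f (finprod G (\<lambda>x. x) B)"
        using B by (subst finprod_hom[OF assms(1) H homh]) auto
      finally show ?thesis
        using P(3)[OF that] by simp
    qed
    moreover have "?f ` B \<inter> ?f ` C = {}" if "B \<in> P" "C \<in> P" "?f ` B \<noteq> ?f ` C" for B C
    proof -
      have "B \<inter> C = {}"
        using P(2) that by blast
      then show ?thesis
        by (simp flip: image_Int[OF inj])
    qed
    ultimately show ?thesis
      using P by (auto simp: heffter_system_def card_image image_Union[symmetric])
  qed
  moreover have "orthogonal_systems (image ?f ` P) (image ?f ` Q)" if "P \<in> S" "Q \<in> S" "P \<noteq> Q" for P Q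
    using orth[OF that] by (auto simp: orthogonal_systems_def card_image simp flip: image_Int[OF inj])
  moreover have "card (image (image ?f) ` S) = r"
  proof -
    have "inj (image (image ?f))"
      by (intro injI) (simp add: inj_image_eq_iff inj_def)
    then show ?thesis
      using assms(5) by (simp add: card_image inj_on_subset)
  qed
  ultimately show ?thesis
    unfolding MOHS_def using H fin_H card_H
    by (intro exI[of _ H] exI[of _ "?f ` V"] exI[of _ "image (image ?f) ` S"]) auto
qed

section \<open>Orbits of length \<open>k\<^sup>2\<close> and their signed half-sets\<close>

text \<open>Points of the orbit may be replaced by their inverses. Doing so on whole residue classes modulo \<open>k\<close>,
  those in \<open>s\<close>, keeps the half-set invariant under \<open>\<phi> ^^ k\<close>.\<close>

locale heffter_orbit = comm_group G for G :: "'a monoid" (structure) +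
  fixes \<phi> :: "'a \<Rightarrow> 'a" and x :: 'a and k :: nat and s :: "nat set"
  assumes fin: "finite (carrier G)"
    and card_carrier: "card (carrier G) = 2 * k\<^sup>2 + 1"
    and k: "odd k" "2 \<le> k"
    and hom: "\<phi> \<in> hom G G"
    and x: "x \<in> carrier G"
    and period: "(\<phi> ^^ k\<^sup>2) x = x"
    and no_smaller_period: "\<And>q. 2 \<le> q \<Longrightarrow> q \<le> k \<Longrightarrow> q dvd k \<Longrightarrow> (\<phi> ^^ (k\<^sup>2 div q)) x \<noteq> x"
    and coset_sum: "finprod G (\<lambda>j. (\<phi> ^^ (k * j)) x) {..<k} = \<one>"
begin

definition u :: "nat \<Rightarrow> 'a" where
  "u n = (\<phi> ^^ n) x"

definition e :: "nat \<Rightarrow> 'a" where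
  "e n = (if n mod k \<in> s then inv (u n) else u n)"

definition pt :: "nat \<Rightarrow> nat \<Rightarrow> 'a" where
  "pt i j = e (i + k * j)"

definition V :: "'a set" where
  "V = e ` {..<k\<^sup>2}"

lemma hom_funpow: "\<phi> ^^ n \<in> hom G G"
proof (induction n)
  case (Suc n)
  then show ?case
    using hom Group.hom_compose[of "\<phi> ^^ n" G G \<phi> G] by (simp add: comp_def)
qed (simp add: hom_def)

lemma u_closed [simp]: "u n \<in> carrier G"
  using hom_in_carrier[OF hom_funpow x] by (simp add: u_def)

lemma e_closed [simp]: "e n \<in> carrier G"
  by (simp add: e_def)

lemma inv_inv_iff: "a \<in> carrier G \<Longrightarrow> b \<in> carrier G \<Longrightarrow> inv a = inv b \<longleftrightarrow> a = b"
  by (metis inv_inv)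

lemma funpow_u: "(\<phi> ^^ m) (u n) = u (m + n)"
  by (simp add: u_def funpow_add)

lemma funpow_inv: "a \<in> carrier G \<Longrightarrow> (\<phi> ^^ m) (inv a) = inv ((\<phi> ^^ m) a)"
  using group_hom.hom_inv[of G G "\<phi> ^^ m"] hom_funpow is_group
  by (simp add: group_hom_def group_hom_axioms_def)

text \<open>A shift by a multiple of \<open>k\<close> keeps the residue modulo \<open>k\<close>, and
  with it the sign.\<close>

lemma funpow_e: "(\<phi> ^^ (k * t)) (e n) = e (n + k * t)"
  by (simp add: e_def funpow_inv funpow_u add.commute)

lemma u_add_period: "u (n + k\<^sup>2) = u n"
  using period by (simp add: u_def funpow_add)

lemma u_add_mult_period: "u (n + k\<^sup>2 * m) = u n"
proof (induction m)
  case (Suc m)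
  then show ?case
    using u_add_period[of "n + k\<^sup>2 * m"] by (simp add: algebra_simps)
qed simp

lemma u_mod: "u (n mod k\<^sup>2) = u n"
  by (metis u_add_mult_period mod_mult_div_eq)

lemma u_0: "u 0 = x"
  by (simp add: u_def)

lemma u_mult_fixed: "u d = x \<Longrightarrow> u (n + d * m) = u n"
proof (induction m)
  case (Suc m)
  have "u (n + d * Suc m) = (\<phi> ^^ (n + d * m)) (u d)"
    by (simp add: funpow_u algebra_simps)
  also have "\<dots> = u (n + d * m)"
    using Suc.prems by (simp add: u_def)
  finally show ?case
    using Suc by simp
qed simp

text \<open>By Bezout the gcd of \<open>d\<close> and \<open>k\<^sup>2\<close> is again a period of
  \<open>x\<close>. Were it a proper divisor of \<open>k\<^sup>2\<close>, it would divide
  \<open>k\<^sup>2 div q\<close> for some prime \<open>q\<close> dividing \<open>k\<close>, against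
  \<open>no_smaller_period\<close>.\<close>

lemma u_eq_x_imp_dvd:
  assumes "u d = x"
  shows "k\<^sup>2 dvd d"
proof (cases "d = 0")
  case False
  define g where "g = gcd d (k\<^sup>2)"
  obtain a b where "d * a = k\<^sup>2 * b + g"
    using bezout_nat[OF False, of "k\<^sup>2"] by (auto simp: g_def)
  then have "u g = u (0 + d * a)"
    using u_add_mult_period[of g b] by (simp add: add.commute)
  then have g: "u g = x"
    using u_mult_fixed[OF assms, of 0 a] u_0 by simp
  have "g dvd k\<^sup>2"
    by (simp add: g_def)
  then obtain m where m: "k\<^sup>2 = g * m" ..
  have "m = 1"
  proof (rule ccontr)
    assume "m \<noteq> 1"
    then obtain q where q: "Factorial_Ring.prime q" "q dvd m"
      using prime_factor_nat by blast
    then have "q dvd k"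
      using m by (metis dvd_mult prime_dvd_power)
    then have "u (k\<^sup>2 div q) \<noteq> x"
      using no_smaller_period[of q] q(1) k by (auto simp: u_def prime_ge_2_nat dvd_imp_le)
    moreover have "u (k\<^sup>2 div q) = x"
      using u_mult_fixed[OF g, of 0 "m div q"] q m u_0 by (simp add: div_mult_swap)
    ultimately show False
      by simp
  qed
  then show ?thesis
    using m by (metis g_def gcd_dvd1 mult.right_neutral)
qed simp

lemma u_eq_iff: "u m = u n \<longleftrightarrow> [m = n] (mod k\<^sup>2)"
proof
  assume "[m = n] (mod k\<^sup>2)"
  then show "u m = u n"
    by (metis cong_def u_mod)
next
  have *: "[m = n] (mod k\<^sup>2)" if "u m = u n" "m \<le> n" for m n
  proof -
    have "m \<le> k\<^sup>2 * m"
      using k by simp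
    \<comment> \<open>Cancellation of \<open>m\<close> steps: by periodicity,
      \<open>k\<^sup>2 * m - m\<close> further steps undo them.\<close>
    have "u (n - m) = u (n - m + k\<^sup>2 * m)"
      by (simp add: u_add_mult_period)
    also have "n - m + k\<^sup>2 * m = (k\<^sup>2 * m - m) + n"
      using \<open>m \<le> n\<close> \<open>m \<le> k\<^sup>2 * m\<close> by simp
    also have "u \<dots> = u ((k\<^sup>2 * m - m) + m)"
      using that(1) funpow_u by metis
    also have "\<dots> = u 0"
      using u_add_mult_period[of 0 m] \<open>m \<le> k\<^sup>2 * m\<close> by simp
    finally have "k\<^sup>2 dvd n - m"
      by (simp add: u_0 u_eq_x_imp_dvd)
    then show ?thesis
      using \<open>m \<le> n\<close> by (metis cong_altdef_nat cong_sym)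
  qed
  assume "u m = u n"
  then show "[m = n] (mod k\<^sup>2)"
    using *[of m n] *[of n m] by (cases "m \<le> n") (auto simp: cong_sym)
qed

text \<open>Otherwise some power of \<open>\<phi>\<close> inverts \<open>x\<close>; being of odd order on the orbit, it also fixes \<open>x\<close>,
  so that \<open>x\<close> is an involution in a group of odd order.\<close>

lemma u_neq_inv: "u m \<noteq> inv (u n)"
proof
  assume eq: "u m = inv (u n)"
  \<comment> \<open>After \<open>k\<^sup>2 * n - n\<close> further steps \<open>u n\<close> returns
    to \<open>x\<close>, so \<open>d\<close> steps send \<open>x\<close> to
    \<open>inv x\<close>.\<close>
  define d where "d = k\<^sup>2 * n - n + m"
  have "n \<le> k\<^sup>2 * n"
    using k by simp
  have "u d = (\<phi> ^^ (k\<^sup>2 * n - n)) (inv (u n))"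
    by (simp add: d_def flip: eq funpow_u)
  also have "\<dots> = inv (u (k\<^sup>2 * n))"
    using \<open>n \<le> k\<^sup>2 * n\<close> by (simp add: funpow_inv funpow_u)
  finally have d: "u d = inv x"
    using u_add_mult_period[of 0 n] by (simp add: u_0)
  have alternate: "u (d * j) = (if even j then x else inv x)" for j
  proof (induction j)
    case (Suc j)
    have "u (d * Suc j) = (\<phi> ^^ d) (u (d * j))"
      by (simp add: funpow_u)
    then show ?case
      using Suc d x by (simp add: funpow_inv flip: u_def)
  qed (simp add: u_0)
  have "u (d * k\<^sup>2) = x"
    using u_add_mult_period[of 0 d] by (simp add: mult.commute u_0)
  then have "inv x = x"
    using alternate[of "k\<^sup>2"] k by simp
  then have "x [^] (2::nat) = \<one>"
    using x by (metis l_inv nat_pow_Suc nat_pow_0 l_one numeral_2_eq_2)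
  then have "ord x dvd 2"
    using x by (simp add: pow_eq_id)
  moreover have "ord x dvd 2 * k\<^sup>2 + 1"
    using ord_dvd_group_order[OF x] card_carrier by (simp add: order_def)
  ultimately have "ord x dvd 1"
    by (metis dvd_add_right_iff dvd_mult2)
  then have "x [^] (1::nat) = \<one>"
    using x pow_eq_id by blast
  then have "x = \<one>"
    using x by simp
  \<comment> \<open>Every power of \<open>\<phi>\<close> fixes the unit, which contradicts
    \<open>no_smaller_period\<close> for \<open>q = k\<close>.\<close>
  then have "u (k\<^sup>2 div k) = x"
    unfolding u_def using hom_one[OF hom_funpow is_group is_group] by metis
  then show False
    using no_smaller_period[of k] k by (simp add: u_def)
qed

text \<open>Points of opposite sign differ by \<open>u_neq_inv\<close>; for equal signs the claim is
  \<open>u_eq_iff\<close>. Indices congruent modulo \<open>k\<^sup>2\<close> carry the same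
  sign.\<close>

lemma e_eq_iff: "e m = e n \<longleftrightarrow> [m = n] (mod k\<^sup>2)"
proof -
  have "m mod k = n mod k" if "[m = n] (mod k\<^sup>2)"
    using that by (metis cong_def cong_dvd_modulus_nat dvd_triv_left power2_eq_square)
  then show ?thesis
    using u_neq_inv u_neq_inv[THEN not_sym] by (auto simp: e_def u_eq_iff inv_inv_iff)
qed

text \<open>For equal signs this is \<open>u_neq_inv\<close>. For opposite signs it would give
  \<open>u m = u n\<close>, hence equal residues modulo \<open>k\<close> and equal signs.\<close>

lemma e_neq_inv: "e m \<noteq> inv (e n)"
proof -
  have "m mod k = n mod k" if "[m = n] (mod k\<^sup>2)"
    using that by (metis cong_def cong_dvd_modulus_nat dvd_triv_left power2_eq_square)
  then show ?thesis
    using u_neq_inv u_neq_inv[THEN not_sym] by (auto simp: e_def u_eq_iff inv_inv_iff)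
qed

lemma inj_e: "inj_on e {..<k\<^sup>2}"
  by (auto simp: inj_on_def e_eq_iff cong_def)

lemma card_V: "card V = k\<^sup>2"
  by (simp add: V_def card_image inj_e)

text \<open>A count: \<open>V\<close> and the set of its inverses are disjoint, each of size
  \<open>k\<^sup>2\<close>, so they exhaust the \<open>2 * k\<^sup>2\<close> elements other than the
  unit.\<close>

lemma half_set_V: "half_set G V"
proof -
  have V: "V \<subseteq> carrier G - {\<one>}"
  proof -
    have "e n \<noteq> \<one>" for n
      using e_neq_inv[of n n] by auto
    then show ?thesis
      by (auto simp: V_def)
  qed
  have "inj_on (\<lambda>g. inv g) V"
    using V by (auto intro!: inj_onI simp: inv_inv_iff)
  then have card: "card ((\<lambda>g. inv g) ` V) = k\<^sup>2"
    by (simp add: card_image card_V)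
  have disj: "V \<inter> (\<lambda>g. inv g) ` V = {}"
    by (auto simp: V_def e_neq_inv)
  have fin_V: "finite V"
    by (simp add: V_def)
  have "V \<union> (\<lambda>g. inv g) ` V = carrier G - {\<one>}"
  proof (rule card_subset_eq)
    show "V \<union> (\<lambda>g. inv g) ` V \<subseteq> carrier G - {\<one>}"
      using V by auto
    show "card (V \<union> (\<lambda>g. inv g) ` V) = card (carrier G - {\<one>})"
      using fin_V fin card_carrier by (simp add: card_Un_disjoint disj card card_V)
  qed (use fin in simp)
  moreover have "inv g \<in> V \<longleftrightarrow> g \<in> (\<lambda>g. inv g) ` V" if "g \<in> carrier G" for g
  proof
    assume "inv g \<in> V"
    then show "g \<in> (\<lambda>g. inv g) ` V"
      using that by (intro image_eqI[of _ _ "inv g"]) simp_all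
  next
    assume "g \<in> (\<lambda>g. inv g) ` V"
    then show "inv g \<in> V"
      using V by auto
  qed
  ultimately show ?thesis
    using V disj unfolding half_set_def by blast
qed

section \<open>Coordinates on the half-set, rows and translates of graphs\<close>

lemma pt_closed [simp]: "pt i j \<in> carrier G"
  by (simp add: pt_def)

text \<open>In base \<open>k\<close> the index \<open>i + k * j\<close> has lowest digit
  \<open>i\<close>; reduction modulo \<open>k\<^sup>2\<close> just reduces \<open>j\<close> modulo
  \<open>k\<close>.\<close>

lemma pt_eq_iff:
  assumes "i < k" "i' < k"
  shows "pt i j = pt i' j' \<longleftrightarrow> i = i' \<and> [j = j'] (mod k)"
proof -
  have *: "(i + k * j) mod k\<^sup>2 = k * (j mod k) + i" if "i < k" for i j
    using that by (simp add: power2_eq_square mod_mult2_eq)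
  have "k * (j mod k) + i = k * (j' mod k) + i' \<longleftrightarrow> i = i' \<and> j mod k = j' mod k"
    using assms by (metis add.commute add_left_cancel mod_less mod_mult_self2 mult_left_cancel
        less_nat_zero_code)
  then show ?thesis
    using assms by (simp add: pt_def e_eq_iff cong_def *)
qed

lemma pt_in_V: "pt i j \<in> V"
proof -
  have "pt i j = e ((i + k * j) mod k\<^sup>2)"
    by (simp add: pt_def e_eq_iff cong_def)
  then show ?thesis
    using k by (auto simp: V_def)
qed

lemma V_cases:
  assumes "v \<in> V"
  obtains i j where "i < k" "j < k" "v = pt i j"
proof -
  obtain n where n: "n < k\<^sup>2" "v = e n"
    using assms by (auto simp: V_def)
  have "n div k < k"
    using n by (simp add: power2_eq_square less_mult_imp_div_less)
  then show ?thesis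
    using that[of "n mod k" "n div k"] n k by (simp add: pt_def)
qed

lemma funpow_pt: "(\<phi> ^^ (k * t)) (pt i j) = pt i (j + t)"
  by (simp add: pt_def funpow_e algebra_simps)

definition rows :: "'a set set" where
  "rows = (\<lambda>i. pt i ` {..<k}) ` {..<k}"

text \<open>The function \<open>b\<close> is arbitrary; a line is a translate of its graph, and
  \<open>lines b\<close> is a parallel class.\<close>

definition line :: "(nat \<Rightarrow> nat) \<Rightarrow> nat \<Rightarrow> 'a set" where
  "line b t = (\<lambda>i. pt i (b i + t)) ` {..<k}"

definition lines :: "(nat \<Rightarrow> nat) \<Rightarrow> 'a set set" where
  "lines b = line b ` {..<k}"

lemma inj_row: "i < k \<Longrightarrow> inj_on (pt i) {..<k}"
  by (auto simp: inj_on_def pt_eq_iff cong_def)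

lemma inj_line: "inj_on (\<lambda>i. pt i (b i)) {..<k}"
  by (auto simp: inj_on_def pt_eq_iff)

text \<open>Row \<open>i\<close> is the image of the coset in \<open>coset_sum\<close> under
  \<open>\<phi> ^^ i\<close>, followed by inversion if \<open>i \<in> s\<close>. Inversion is a
  homomorphism because the group is abelian.\<close>

lemma row_sum:
  assumes "i < k"
  shows "finprod G (\<lambda>x. x) (pt i ` {..<k}) = \<one>"
proof -
  let ?\<sigma> = "\<lambda>g. if i \<in> s then inv g else g"
  have \<sigma>: "?\<sigma> \<in> hom G G"
    by (cases "i \<in> s") (auto simp: hom_def inv_mult)
  have pt: "pt i j = ?\<sigma> ((\<phi> ^^ i) (u (k * j)))" for j
    using assms by (simp add: pt_def e_def funpow_u)
  have "finprod G (\<lambda>x. x) (pt i ` {..<k}) = finprod G (pt i) {..<k}"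
    using inj_row[OF assms] by (subst finprod_reindex) auto
  also have "\<dots> = ?\<sigma> (finprod G (\<lambda>j. (\<phi> ^^ i) (u (k * j))) {..<k})"
    unfolding pt by (subst finprod_hom[OF _ _ \<sigma>]) (auto simp: funpow_u comm_group_axioms)
  also have "finprod G (\<lambda>j. (\<phi> ^^ i) (u (k * j))) {..<k} =
      (\<phi> ^^ i) (finprod G (\<lambda>j. u (k * j)) {..<k})"
    by (subst finprod_hom[OF _ _ hom_funpow]) (auto simp: comm_group_axioms)
  also have "\<dots> = \<one>"
    using coset_sum hom_one[OF hom_funpow is_group is_group] by (simp add: u_def)
  finally show ?thesis
    by (simp split: if_splits)
qed

lemma line_sum:
  assumes "finprod G (\<lambda>i. pt i (b i)) {..<k} = \<one>"
  shows "finprod G (\<lambda>x. x) (line b t) = \<one>"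
proof -
  have "finprod G (\<lambda>x. x) (line b t) = finprod G (\<lambda>i. pt i (b i + t)) {..<k}"
    unfolding line_def using inj_line[of "\<lambda>i. b i + t"] by (subst finprod_reindex) auto
  also have "\<dots> = finprod G (\<lambda>i. (\<phi> ^^ (k * t)) (pt i (b i))) {..<k}"
    by (simp add: funpow_pt)
  also have "\<dots> = (\<phi> ^^ (k * t)) (finprod G (\<lambda>i. pt i (b i)) {..<k})"
    by (subst finprod_hom[OF _ _ hom_funpow]) (auto simp: comm_group_axioms)
  finally show ?thesis
    using assms hom_one[OF hom_funpow is_group is_group] by simp
qed

lemma heffter_rows: "heffter_system G V k rows"
proof -
  have "\<Union>rows = V"
    by (auto simp: rows_def pt_in_V elim!: V_cases)
  moreover have "B \<inter> C = {}" if "B \<in> rows" "C \<in> rows" "B \<noteq> C" for B C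
    using that by (auto simp: rows_def pt_eq_iff)
  ultimately show ?thesis
    unfolding heffter_system_def by (auto simp: rows_def row_sum card_image inj_row)
qed

lemma heffter_lines:
  assumes "finprod G (\<lambda>i. pt i (b i)) {..<k} = \<one>"
  shows "heffter_system G V k (lines b)"
proof -
  have "v \<in> \<Union>(lines b)" if "v \<in> V" for v
  proof -
    obtain i j where ij: "i < k" "v = pt i j"
      using \<open>v \<in> V\<close> by (elim V_cases)
    \<comment> \<open>This is \<open>j - b i\<close> modulo \<open>k\<close>, with
      \<open>(k - 1) * b i\<close> standing for the negative of \<open>b i\<close> in the
      naturals.\<close>
    define t where "t = (j + (k - 1) * b i) mod k"
    have "[b i + t = b i + (j + (k - 1) * b i)] (mod k)"
      by (simp add: t_def cong_def mod_add_right_eq)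
    also have "b i + (j + (k - 1) * b i) = j + k * b i"
      using k by (cases k) simp_all
    also have "[j + k * b i = j] (mod k)"
      by (simp add: cong_def)
    finally have "v = pt i (b i + t)"
      using ij by (simp add: pt_eq_iff cong_sym)
    moreover have "t < k"
      using k by (simp add: t_def)
    ultimately show ?thesis
      using ij by (auto simp: lines_def line_def)
  qed
  then have "\<Union>(lines b) = V"
    by (auto simp: lines_def line_def pt_in_V)
  moreover have "B \<inter> C = {}" if "B \<in> lines b" "C \<in> lines b" "B \<noteq> C" for B C
  proof -
    have "t = t'" if "t < k" "t' < k" "line b t \<inter> line b t' \<noteq> {}" for t t'
    proof -
      obtain i where "[b i + t = b i + t'] (mod k)"
        using \<open>line b t \<inter> line b t' \<noteq> {}\<close> by (auto simp: line_def pt_eq_iff)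
      then show ?thesis
        using that by (simp add: cong_add_lcancel_nat cong_less_modulus_unique_nat)
    qed
    then show ?thesis
      using that by (auto simp: lines_def)
  qed
  moreover have "finite (line b t) \<and> card (line b t) = k" for t
    using inj_line[of "\<lambda>i. b i + t"] by (simp add: line_def card_image)
  ultimately show ?thesis
    unfolding heffter_system_def by (auto simp: lines_def line_sum[OF assms])
qed

lemma orthogonal_rows_lines: "orthogonal_systems rows (lines b)"
proof -
  have "card (pt i ` {..<k} \<inter> line b t) \<le> 1" if "i < k" for i t
  proof -
    have "pt i ` {..<k} \<inter> line b t \<subseteq> {pt i (b i + t)}"
      using that by (auto simp: line_def pt_eq_iff)
    then show ?thesis
      using card_mono[of "{pt i (b i + t)}"] by simp
  qed
  then show ?thesis
    by (auto simp: orthogonal_systems_def rows_def lines_def)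
qed

lemma orthogonal_lines:
  assumes "\<And>i i' t t'. i < k \<Longrightarrow> i' < k \<Longrightarrow> [b i + t = b' i + t'] (mod k) \<Longrightarrow>
    [b i' + t = b' i' + t'] (mod k) \<Longrightarrow> i = i'"
  shows "orthogonal_systems (lines b) (lines b')"
proof -
  have "card (line b t \<inter> line b' t') \<le> 1" for t t'
  proof -
    have "v = w" if "v \<in> line b t \<inter> line b' t'" "w \<in> line b t \<inter> line b' t'" for v w
    proof -
      have *: "\<exists>i<k. v = pt i (b i + t) \<and> [b i + t = b' i + t'] (mod k)"
        if "v \<in> line b t \<inter> line b' t'" for v
        using that by (auto simp: line_def pt_eq_iff)
      show ?thesis
        using *[of v] *[of w] that assms by blast
    qed
    moreover have "finite (line b t \<inter> line b' t')"
      by (simp add: line_def)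
    ultimately show ?thesis
      unfolding One_nat_def by (subst card_le_Suc0_iff_eq) blast+
  qed
  then show ?thesis
    by (auto simp: orthogonal_systems_def lines_def)
qed

text \<open>A block meets itself in \<open>k \<ge> 2\<close> points. This distinguishes the systems,
  so that a set of them has the required cardinality.\<close>

lemma orthogonal_imp_neq:
  assumes "heffter_system G V k P" "orthogonal_systems P Q"
  shows "P \<noteq> Q"
proof
  assume "P = Q"
  have "\<Union>P \<noteq> {}"
    using assms(1) pt_in_V[of 0 0] by (auto simp: heffter_system_def)
  then obtain B where "B \<in> P"
    by blast
  then have "card B = k"
    using assms(1) unfolding heffter_system_def by blast
  moreover have "card (B \<inter> B) \<le> 1"
    using assms(2) \<open>B \<in> P\<close> \<open>P = Q\<close> unfolding orthogonal_systems_def by blast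
  ultimately show False
    using k by simp
qed

end

section \<open>Orthogonal families from one pair of functions\<close>

lemma orthogonal_systems_sym: "orthogonal_systems P Q \<Longrightarrow> orthogonal_systems Q P"
  unfolding orthogonal_systems_def by (metis Int_commute)

text \<open>If translates for \<open>a < a'\<close> meet over both \<open>i\<close> and
  \<open>i'\<close>, subtraction gives \<open>(a' - a) * d i\<close> congruent to
  \<open>(a' - a) * d i'\<close> modulo \<open>k\<close>. The unit \<open>a' - a\<close> cancels,
  and \<open>d\<close> is injective modulo \<open>k\<close>.\<close>

lemma (in heffter_orbit) orbit_MOHS:
  fixes c d :: "nat \<Rightarrow> nat" and A :: "nat set"
  assumes d: "inj_on (\<lambda>i. d i mod k) {..<k}"
    and A: "finite A" "\<And>a a'. a \<in> A \<Longrightarrow> a' \<in> A \<Longrightarrow> a < a' \<Longrightarrow> coprime (a' - a) k"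
    and sum: "\<And>a. a \<in> A \<Longrightarrow> finprod G (\<lambda>i. pt i ((c i + a * d i) mod k)) {..<k} = \<one>"
  obtains S where "card S = card A + 1" "\<And>P. P \<in> S \<Longrightarrow> heffter_system G V k P"
    "\<And>P Q. P \<in> S \<Longrightarrow> Q \<in> S \<Longrightarrow> P \<noteq> Q \<Longrightarrow> orthogonal_systems P Q"
proof
  let ?b = "\<lambda>a i. c i + a * d i"
  define S where "S = insert rows ((\<lambda>a. lines (?b a)) ` A)"
  have heffter: "heffter_system G V k (lines (?b a))" if "a \<in> A" for a
  proof (rule heffter_lines)
    \<comment> \<open>The second coordinate matters only modulo \<open>k\<close>; its reduced form
      keeps later table lookups in range.\<close>
    have "finprod G (\<lambda>i. pt i (?b a i)) {..<k} = finprod G (\<lambda>i. pt i (?b a i mod k)) {..<k}"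
      by (intro finprod_cong') (auto simp: pt_eq_iff cong_def)
    then show "finprod G (\<lambda>i. pt i (?b a i)) {..<k} = \<one>"
      using sum[OF that] by simp
  qed
  have orth_less: "orthogonal_systems (lines (?b a)) (lines (?b a'))"
    if "a \<in> A" "a' \<in> A" "a < a'" for a a'
  proof (rule orthogonal_lines)
    fix i i' t t'
    assume i: "i < k" "i' < k"
      and "[?b a i + t = ?b a' i + t'] (mod k)" "[?b a i' + t = ?b a' i' + t'] (mod k)"
    moreover have split: "?b a' l = ?b a l + (a' - a) * d l" for l
      using \<open>a < a'\<close> by (simp add: add_mult_distrib[symmetric])
    ultimately have "[t = (a' - a) * d i + t'] (mod k)" "[t = (a' - a) * d i' + t'] (mod k)"
      unfolding split add.assoc by (simp_all add: cong_add_lcancel_nat)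
    then have "[(a' - a) * d i + t' = (a' - a) * d i' + t'] (mod k)"
      by (metis cong_sym cong_trans)
    then have "[d i = d i'] (mod k)"
      using A(2)[OF that] by (simp add: cong_add_rcancel_nat cong_mult_lcancel_nat coprime_commute)
    then show "i = i'"
      using i inj_onD[OF d, of i i'] by (simp add: cong_def)
  qed
  have orth: "orthogonal_systems (lines (?b a)) (lines (?b a'))"
    if "a \<in> A" "a' \<in> A" "a \<noteq> a'" for a a'
    using orth_less[of a a'] orth_less[of a' a] that orthogonal_systems_sym by (cases "a < a'") auto
  have inj: "inj_on (\<lambda>a. lines (?b a)) A"
    using orthogonal_imp_neq[OF heffter orth] by (meson inj_onI)
  have "rows \<notin> (\<lambda>a. lines (?b a)) ` A"
    using orthogonal_imp_neq[OF heffter_rows orthogonal_rows_lines] by blast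
  then show "card S = card A + 1"
    using A(1) inj by (simp add: S_def card_image)
  show "heffter_system G V k P" if "P \<in> S" for P
    using that heffter heffter_rows by (auto simp: S_def)
  show "orthogonal_systems P Q" if "P \<in> S" "Q \<in> S" "P \<noteq> Q" for P Q
    using that unfolding S_def
    by (auto intro!: orth orthogonal_rows_lines orthogonal_systems_sym[OF orthogonal_rows_lines])
qed

section \<open>The groups \<open>\<int>_p^n\<close> as lists, and multiplication by
  \<open>X\<close>\<close>

definition vec_add :: "int \<Rightarrow> int list \<Rightarrow> int list \<Rightarrow> int list" where
  "vec_add p xs ys = map2 (\<lambda>a b. (a + b) mod p) xs ys"

definition vec_neg :: "int \<Rightarrow> int list \<Rightarrow> int list" where
  "vec_neg p xs = map (\<lambda>a. - a mod p) xs"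

text \<open>One executable encoding serves both the prime fields, with \<open>n = 1\<close>, and the
  field with 243 elements. The element type is countable, as \<open>MOHS_transfer\<close>
  demands.\<close>

definition vec_group :: "int \<Rightarrow> nat \<Rightarrow> int list monoid" where
  "vec_group p n = \<lparr>carrier = {xs. set xs \<subseteq> {0..<p} \<and> length xs = n},
    monoid.mult = vec_add p, one = replicate n 0\<rparr>"

text \<open>Multiplication by \<open>X\<close> modulo \<open>p\<close> and a monic polynomial in \<open>X\<close>; \<open>f\<close> lists the coefficients of the
  negated lower-order part, lowest degree first.\<close>

definition mult_X :: "int \<Rightarrow> int list \<Rightarrow> int list \<Rightarrow> int list" where
  "mult_X p f xs = map2 (\<lambda>a b. (a + last xs * b) mod p) (0 # butlast xs) f"

lemma carrier_vec_group: "xs \<in> carrier (vec_group p n) \<longleftrightarrow> set xs \<subseteq> {0..<p} \<and> length xs = n"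
  by (simp add: vec_group_def)

lemma mult_vec_group: "xs \<otimes>\<^bsub>vec_group p n\<^esub> ys = vec_add p xs ys"
  and one_vec_group: "\<one>\<^bsub>vec_group p n\<^esub> = replicate n 0"
  by (simp_all add: vec_group_def)

lemma carrier_vec_group_nth:
  "xs \<in> carrier (vec_group p n) \<longleftrightarrow> length xs = n \<and> (\<forall>i<n. 0 \<le> xs ! i \<and> xs ! i < p)"
  by (auto simp: carrier_vec_group set_conv_nth)

lemma length_vec_add [simp]: "length (vec_add p xs ys) = min (length xs) (length ys)"
  and nth_vec_add [simp]:
    "i < length xs \<Longrightarrow> i < length ys \<Longrightarrow> vec_add p xs ys ! i = (xs ! i + ys ! i) mod p"
  by (simp_all add: vec_add_def)

lemma vec_neg:
  assumes "0 < p" "xs \<in> carrier (vec_group p n)"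
  shows "vec_neg p xs \<in> carrier (vec_group p n)" "vec_add p (vec_neg p xs) xs = replicate n 0"
  using assms
  by (auto simp: carrier_vec_group_nth vec_neg_def mod_simps intro!: nth_equalityI)

lemma comm_group_vec_group:
  assumes "0 < p"
  shows "comm_group (vec_group p n)"
proof (rule comm_groupI)
  show "\<exists>y\<in>carrier (vec_group p n). y \<otimes>\<^bsub>vec_group p n\<^esub> x = \<one>\<^bsub>vec_group p n\<^esub>"
    if "x \<in> carrier (vec_group p n)" for x
    using vec_neg[OF assms that] by (auto simp: mult_vec_group one_vec_group)
qed (use assms in \<open>auto simp: mult_vec_group one_vec_group carrier_vec_group_nth mod_simps
  algebra_simps intro!: nth_equalityI\<close>)

lemma inv_vec_group:
  assumes "0 < p" "xs \<in> carrier (vec_group p n)"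
  shows "inv\<^bsub>vec_group p n\<^esub> xs = vec_neg p xs"
proof -
  interpret comm_group "vec_group p n"
    by (rule comm_group_vec_group) fact
  show ?thesis
    using vec_neg[OF assms] assms(2) by (intro inv_equality) (simp_all add: mult_vec_group one_vec_group)
qed

lemma finite_vec_group: "finite (carrier (vec_group p n))"
  by (simp add: vec_group_def finite_lists_length_eq)

lemma card_vec_group: "card (carrier (vec_group p n)) = nat p ^ n"
  by (simp add: vec_group_def card_lists_length_eq)

lemma mult_X_hom:
  assumes "0 < p" "length f = n" "0 < n"
  shows "mult_X p f \<in> hom (vec_group p n) (vec_group p n)"
proof (rule homI)
  fix xs ys
  assume xs: "xs \<in> carrier (vec_group p n)"
  then have "xs \<noteq> []"
    using assms by (auto simp: carrier_vec_group)
  then show "mult_X p f xs \<in> carrier (vec_group p n)"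
    using xs assms by (auto simp: mult_X_def carrier_vec_group_nth)
  assume ys: "ys \<in> carrier (vec_group p n)"
  then have "ys \<noteq> []" "length ys = n" "length xs = n"
    using assms xs by (auto simp: carrier_vec_group)
  moreover have "vec_add p xs ys \<noteq> []"
    using calculation assms by (simp flip: length_greater_0_conv)
  ultimately have last: "last (vec_add p xs ys) = (last xs + last ys) mod p"
    using \<open>xs \<noteq> []\<close> assms by (simp add: last_conv_nth)
  \<comment> \<open>One coordinate of additivity: \<open>a\<close>, \<open>b\<close> are the shifted
    entries, \<open>y\<close>, \<open>z\<close> the last entries and \<open>w\<close> the
    coefficient in \<open>f\<close>. At position 0 the shifted entries are 0.\<close>
  have distrib: "((a + b) mod p + (y + z) mod p * w) mod p =
      ((a + y * w) mod p + (b + z * w) mod p) mod p" for a b y z w :: int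
  proof -
    have "((a + b) mod p + (y + z) mod p * w) mod p = (a + b + (y + z) mod p * w) mod p"
      by (rule mod_add_left_eq)
    also have "\<dots> = (a + b + ((y + z) mod p * w) mod p) mod p"
      by (rule mod_add_right_eq[symmetric])
    also have "\<dots> = (a + b + (y + z) * w) mod p"
      by (simp only: mod_mult_left_eq mod_add_right_eq)
    also have "\<dots> = ((a + y * w) + (b + z * w)) mod p"
      by (simp add: algebra_simps)
    also have "\<dots> = ((a + y * w) mod p + (b + z * w) mod p) mod p"
      by (rule mod_add_eq[symmetric])
    finally show ?thesis .
  qed
  show "mult_X p f (xs \<otimes>\<^bsub>vec_group p n\<^esub> ys) =
      mult_X p f xs \<otimes>\<^bsub>vec_group p n\<^esub> mult_X p f ys"
  proof (rule nth_equalityI)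
    show "length (mult_X p f (xs \<otimes>\<^bsub>vec_group p n\<^esub> ys)) =
        length (mult_X p f xs \<otimes>\<^bsub>vec_group p n\<^esub> mult_X p f ys)"
      using \<open>length xs = n\<close> \<open>length ys = n\<close> assms by (simp add: mult_X_def mult_vec_group)
  next
    fix i assume "i < length (mult_X p f (xs \<otimes>\<^bsub>vec_group p n\<^esub> ys))"
    then have "i < n"
      using assms by (simp add: mult_X_def)
    then show "mult_X p f (xs \<otimes>\<^bsub>vec_group p n\<^esub> ys) ! i =
        (mult_X p f xs \<otimes>\<^bsub>vec_group p n\<^esub> mult_X p f ys) ! i"
      using \<open>length xs = n\<close> \<open>length ys = n\<close> assms last
      by (cases i) (simp_all add: mult_X_def mult_vec_group nth_butlast distrib distrib[of 0 0, simplified])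
  qed
qed

section \<open>Computable certificates\<close>

definition vec_sum :: "int \<Rightarrow> nat \<Rightarrow> int list list \<Rightarrow> int list" where
  "vec_sum p n xss = foldr (vec_add p) xss (replicate n 0)"

fun powers :: "int \<Rightarrow> int list \<Rightarrow> int list \<Rightarrow> nat \<Rightarrow> int list list" where
  "powers p f xs 0 = []"
| "powers p f xs (Suc m) = xs # powers p f (mult_X p f xs) m"

lemma nth_powers: "i < m \<Longrightarrow> powers p f xs m ! i = (mult_X p f ^^ i) xs"
proof (induction m arbitrary: i xs)
  case (Suc m)
  then show ?case
    by (cases i) (simp_all add: funpow_swap1)
qed simp

text \<open>The computable form of \<open>pt\<close>, reading the orbit from the table
  \<open>us\<close>.\<close>

definition signed_power :: "int \<Rightarrow> int list list \<Rightarrow> nat \<Rightarrow> nat list \<Rightarrow> nat \<Rightarrow> nat \<Rightarrow> int list" where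
  "signed_power p us k s i j =
    (if i \<in> set s then vec_neg p (us ! (i + k * j)) else us ! (i + k * j))"

definition valid_orbit :: "int \<Rightarrow> int list \<Rightarrow> int list list \<Rightarrow> nat \<Rightarrow> bool" where
  "valid_orbit p x us k \<longleftrightarrow> us ! (k\<^sup>2) = x \<and>
    (\<forall>q \<in> set [2..<Suc k]. q dvd k \<longrightarrow> us ! (k\<^sup>2 div q) \<noteq> x) \<and>
    vec_sum p (length x) (map (\<lambda>j. us ! (k * j)) [0..<k]) = replicate (length x) 0"

definition valid_lines ::
  "int \<Rightarrow> nat \<Rightarrow> int list list \<Rightarrow> nat \<Rightarrow> nat list \<Rightarrow> nat list \<Rightarrow> nat list \<Rightarrow> nat list \<Rightarrow> bool" where
  "valid_lines p n us k s c d as \<longleftrightarrow>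
    (\<forall>a \<in> set as. vec_sum p n
      (map (\<lambda>i. signed_power p us k s i ((c ! i + a * d ! i) mod k)) [0..<k]) = replicate n 0)"

text \<open>All conditions on the orbit and on the sums become finite checks on a table of powers.
  It has \<open>k\<^sup>2 + 1\<close> entries, so that the return to \<open>x\<close> at index
  \<open>k\<^sup>2\<close> can be read off.\<close>

lemma MOHS_of_orbit:
  assumes p: "0 < p" and f: "length f = n" "0 < n"
    and k: "odd k" "2 \<le> k" and card: "nat p ^ n = 2 * k\<^sup>2 + 1"
    and x: "x \<in> carrier (vec_group p n)"
    and orbit: "valid_orbit p x (powers p f x (k\<^sup>2 + 1)) k"
    and lines: "valid_lines p n (powers p f x (k\<^sup>2 + 1)) k s c d as"
    and d: "distinct (map (\<lambda>i. d ! i mod k) [0..<k])"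
    and as: "distinct as" "\<forall>a \<in> set as. \<forall>a' \<in> set as. a < a' \<longrightarrow> coprime (a' - a) k"
    and "v = k\<^sup>2" "r = length as + 1"
  shows "MOHS v k r"
proof -
  let ?G = "vec_group p n"
  define us where "us = powers p f x (k\<^sup>2 + 1)"
  note orbit = orbit[folded us_def] and lines = lines[folded us_def]
  interpret comm_group ?G
    using p by (rule comm_group_vec_group)
  have us_nth: "us ! i = (mult_X p f ^^ i) x" if "i \<le> k\<^sup>2" for i
    using that by (simp add: us_def nth_powers del: powers.simps)
  have n: "length x = n"
    using x by (simp add: carrier_vec_group)
  have hom: "mult_X p f \<in> hom ?G ?G"
    using p f by (rule mult_X_hom)
  have funpow_closed: "(mult_X p f ^^ i) x \<in> carrier ?G" for i
    by (induction i) (use x hom_in_carrier[OF hom] in auto)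
  have finprod: "finprod ?G g {..<k} = vec_sum p n (map g [0..<k])"
    if "\<And>i. g i \<in> carrier ?G" for g
    using finprod_set_eq_foldr[of "[0..<k]" g] that
    by (simp add: vec_sum_def one_vec_group mult_vec_group[abs_def] atLeast0LessThan)
  have index: "i + k * j < k\<^sup>2" if "i < k" "j < k" for i j
  proof -
    have "i + k * j < k * Suc j"
      using that by simp
    also have "\<dots> \<le> k * k"
      using that by (intro mult_left_mono) auto
    finally show ?thesis
      by (simp add: power2_eq_square)
  qed
  interpret heffter_orbit ?G "mult_X p f" x k "set s"
  proof unfold_locales
    show "(mult_X p f ^^ (k\<^sup>2 div q)) x \<noteq> x" if "2 \<le> q" "q \<le> k" "q dvd k" for q
      using orbit that us_nth[of "k\<^sup>2 div q"] by (auto simp: valid_orbit_def)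
    have sum: "vec_sum p n (map (\<lambda>j. us ! (k * j)) [0..<k]) = replicate n 0"
      using orbit by (simp add: valid_orbit_def n)
    have map: "map (\<lambda>j. us ! (k * j)) [0..<k] = map (\<lambda>j. (mult_X p f ^^ (k * j)) x) [0..<k]"
      using index[of 0] k by (intro map_cong) (auto simp: us_nth less_imp_le)
    show "(\<Otimes>\<^bsub>?G\<^esub>j\<in>{..<k}. (mult_X p f ^^ (k * j)) x) = \<one>\<^bsub>?G\<^esub>"
      unfolding finprod[OF funpow_closed] one_vec_group map[symmetric] by (rule sum)
  qed (use orbit us_nth[of "k\<^sup>2"] in \<open>simp_all add: finite_vec_group card_vec_group card k hom x
      valid_orbit_def\<close>)
  have pt: "pt i j = signed_power p us k s i j" if "i < k" "j < k" for i j
    using that index[OF that] p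
    by (simp add: pt_def e_def u_def signed_power_def us_nth inv_vec_group funpow_closed)
  have "finprod ?G (\<lambda>i. pt i ((c ! i + a * d ! i) mod k)) {..<k} = \<one>\<^bsub>?G\<^esub>" if "a \<in> set as" for a
  proof -
    have sum: "vec_sum p n (map (\<lambda>i. signed_power p us k s i ((c ! i + a * d ! i) mod k)) [0..<k]) =
        replicate n 0"
      using lines that by (simp add: valid_lines_def)
    have map: "map (\<lambda>i. pt i ((c ! i + a * d ! i) mod k)) [0..<k] =
        map (\<lambda>i. signed_power p us k s i ((c ! i + a * d ! i) mod k)) [0..<k]"
      using k by (intro map_cong) (simp_all add: pt)
    show ?thesis
      unfolding finprod[OF pt_closed] one_vec_group map by (rule sum)
  qed
  moreover have "inj_on (\<lambda>i. d ! i mod k) {..<k}"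
    using d by (simp add: distinct_map atLeast0LessThan)
  ultimately obtain S where "card S = card (set as) + 1" "\<And>P. P \<in> S \<Longrightarrow> heffter_system ?G V k P"
    "\<And>P Q. P \<in> S \<Longrightarrow> Q \<in> S \<Longrightarrow> P \<noteq> Q \<Longrightarrow> orthogonal_systems P Q"
    using orbit_MOHS[of "(!) d" "set as" "(!) c"] as(2) by auto
  then show ?thesis
    using MOHS_transfer[OF comm_group_axioms fin card_carrier half_set_V] distinct_card[OF as(1)] assms(13,14)
    by simp
qed

section \<open>The four certificates\<close>

text \<open>For \<open>n = 1\<close> the map \<open>mult_X\<close> is multiplication by the single
  entry of \<open>f\<close>; here 4 has order 81 modulo 163. Since 3 divides \<open>k\<close>, at
  most three values of \<open>a\<close> can have pairwise unit differences, and 0, 1, 2 attain this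
  bound.\<close>

lemma MOHS_9: "MOHS 81 9 4"
proof (rule MOHS_of_orbit)
  show "valid_orbit 163 [1] (powers 163 [4] [1] (9\<^sup>2 + 1)) 9"
    by code_simp
  show "valid_lines 163 1 (powers 163 [4] [1] (9\<^sup>2 + 1)) 9 []
      [0, 6, 2, 0, 8, 0, 8, 1, 2]
      [0, 4, 5, 1, 7, 2, 8, 3, 6]
      [0, 1, 2]"
    by code_simp
qed (simp_all add: carrier_vec_group, code_simp+)

text \<open>The field is given by \<open>X^5 = X + 1\<close> over \<open>\<int>_3\<close>. Frobenius
  triples exponents, and the signs sit on the nonresidues modulo 11, a set closed under tripling.
  Modulo 11, \<open>c (3 * i mod 11) = 3 * c i + 3 * i div 11\<close>, while \<open>d i\<close> is
  \<open>i\<close> on residues and \<open>9 * i\<close> on nonresidues, so every graph is invariant.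
  The last list holds eight \<open>a\<close> with vanishing sum; their differences are units as 11
  is prime.\<close>

lemma MOHS_11: "MOHS 121 11 9"
proof (rule MOHS_of_orbit)
  show "valid_orbit 3 [1, 0, 0, 0, 0] (powers 3 [1, 1, 0, 0, 0] [1, 0, 0, 0, 0] (11\<^sup>2 + 1)) 11"
    by code_simp
  show "valid_lines 3 5 (powers 3 [1, 1, 0, 0, 0] [1, 0, 0, 0, 0] (11\<^sup>2 + 1)) 11 [2, 6, 7, 8, 10]
      [0, 0, 1, 0, 7, 2, 3, 10, 7, 0, 9]
      [0, 1, 7, 3, 4, 5, 10, 8, 6, 9, 2]
      [0, 1, 2, 5, 6, 7, 8, 9]"
    by code_simp
qed (simp_all add: carrier_vec_group, code_simp+)

text \<open>Here 4 has order 441 modulo 883, and \<open>d\<close> is the identity.\<close>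

lemma MOHS_21: "MOHS 441 21 4"
proof (rule MOHS_of_orbit)
  show "valid_orbit 883 [1] (powers 883 [4] [1] (21\<^sup>2 + 1)) 21"
    by code_simp
  show "valid_lines 883 1 (powers 883 [4] [1] (21\<^sup>2 + 1)) 21 []
      [0, 13, 11, 15, 14, 15, 0, 9, 8, 14, 6, 14, 3, 1, 7, 18, 5, 13, 11, 8, 2]
      [0, 1, 2, 3, 4, 5, 6, 7, 8, 9, 10, 11, 12, 13, 14, 15, 16, 17, 18, 19, 20]
      [0, 1, 2]"
    by code_simp
qed (simp_all add: carrier_vec_group, code_simp+)

text \<open>Here 6 has order 729 modulo 1459, and \<open>d\<close> is the identity.\<close>

lemma MOHS_27: "MOHS 729 27 4"
proof (rule MOHS_of_orbit)
  show "valid_orbit 1459 [1] (powers 1459 [6] [1] (27\<^sup>2 + 1)) 27"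
    by code_simp
  show "valid_lines 1459 1 (powers 1459 [6] [1] (27\<^sup>2 + 1)) 27 []
      [0, 8, 26, 20, 11, 24, 3, 9, 5, 3, 4, 17, 14, 20, 20, 14, 21, 5, 24, 2, 1, 3, 19, 11, 20, 11, 0]
      [0, 1, 2, 3, 4, 5, 6, 7, 8, 9, 10, 11, 12, 13, 14, 15, 16, 17, 18, 19, 20, 21, 22, 23, 24, 25, 26]
      [0, 1, 2]"
    by code_simp
qed (simp_all add: carrier_vec_group, code_simp+)

theorem theorem1p15:
  shows "(\<forall>k \<in> {9, 21, 27}. MOHS (k^2) k 4) \<and> MOHS 121 11 9"
  using MOHS_9 MOHS_11 MOHS_21 MOHS_27 by simp

end
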